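(* Let $1<p\le 2$ and let $q=p/(p-1)$. Let $\omega\in\Lambda^p_\sigma$ for some $\sigma>0$, and let $f^\star$ be the best approximant to $\omega$ in $A^p$. Then $f^\star\in\Lambda^p_{\sigma/q}$.
   Context: $\mathbf{D}$ is the open unit disk in $\mathbf{C}$ with normalized area measure $dA=\frac1\pi\,dx\,dy$; $L^p=L^p(\mathbf{D},dA)$; $A^p$ is the Bergman space of analytic functions on $\mathbf{D}$ belonging to $L^p$. The best approximant to $\omega$ in $A^p$ is the (unique, since $1<p<\infty$) function $f^\star\in A^p$ with $\|\omega-f^\star\|_p=\inf_{f\in A^p}\|\omega-f\|_p$. For $u\in L^p$ and $|\alpha|=1$ put $R_\alpha u(z)=u(\alpha z)$. For $\sigma>0$, the class $\Lambda^p_\sigma$ consists of all $u\in L^p$ such that, for $0\le t\le\pi$, $\|R_{e^{it}}u+R_{e^{-it}}u-2u\|_p=O(t^\sigma)$, i.e. this quantity is at most $Ct^\sigma$ for a constant $C$ independent of $t$. *)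

theory Defs
  imports "HOL-Analysis.Analysis"
begin

text \<open>
  Functions on the unit disk are represented by total functions of type
  \<^typ>\<open>complex \<Rightarrow> complex\<close>; since the space of the measure below is the open unit disk,
  nothing defined here depends on their values outside it.  Elements of the Lebesgue space are
  represented by functions rather than by classes modulo almost everywhere equality.
\<close>

definition disk_area :: "complex measure" where
  "disk_area = scale_measure (ennreal (1 / pi)) (lebesgue_on (ball 0 1))"

definition Lp_disk :: "real \<Rightarrow> (complex \<Rightarrow> complex) set" where
  "Lp_disk p = {u. u \<in> borel_measurable disk_area \<and>
                   integrable disk_area (\<lambda>z. norm (u z) powr p)}"

definition Lp_norm :: "real \<Rightarrow> (complex \<Rightarrow> complex) \<Rightarrow> real" where
  "Lp_norm p u = (LINT z|disk_area. norm (u z) powr p) powr (1 / p)"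

definition bergman_space :: "real \<Rightarrow> (complex \<Rightarrow> complex) set" where
  "bergman_space p = {f. f analytic_on ball 0 1 \<and> f \<in> Lp_disk p}"

definition is_best_approximant ::
    "real \<Rightarrow> (complex \<Rightarrow> complex) \<Rightarrow> (complex \<Rightarrow> complex) \<Rightarrow> bool" where
  "is_best_approximant p \<omega> f \<longleftrightarrow>
     f \<in> bergman_space p \<and>
     Lp_norm p (\<lambda>z. \<omega> z - f z) = (INF g\<in>bergman_space p. Lp_norm p (\<lambda>z. \<omega> z - g z))"

definition rotation :: "complex \<Rightarrow> (complex \<Rightarrow> complex) \<Rightarrow> complex \<Rightarrow> complex" where
  "rotation \<alpha> u = (\<lambda>z. u (\<alpha> * z))"

definition Lambda_class :: "real \<Rightarrow> real \<Rightarrow> (complex \<Rightarrow> complex) set" where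
  "Lambda_class p \<sigma> = {u. u \<in> Lp_disk p \<and>
     (\<exists>C. \<forall>t. 0 \<le> t \<and> t \<le> pi \<longrightarrow>
        Lp_norm p (\<lambda>z. rotation (cis t) u z + rotation (cis (- t)) u z - 2 * u z) \<le> C * t powr \<sigma>)}"

end

theory Submission
  imports Defs
begin

text \<open>
  Let \<open>f\<^sub>t\<close> be the mean of the two rotations of the best approximant \<open>f\<close> by the angles \<open>\<plusminus>t\<close>; it
  lies in the Bergman space.  Since rotations are isometries, \<open>\<omega> - f\<^sub>t\<close> has norm at most
  \<open>d + O(t\<^sup>\<sigma>)\<close>, where \<open>d\<close> is the norm of \<open>\<omega> - f\<close>, while the midpoint of \<open>\<omega> - f\<^sub>t\<close> and
  \<open>\<omega> - f\<close> still has norm at least \<open>d\<close> by minimality.  The 2-uniform convexity of the Lebesgue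
  spaces with exponent at most 2 then gives a bound of order \<open>t\<close> to the power \<open>\<sigma>/2\<close> for the norm of
  \<open>f\<^sub>t - f\<close>, which is half the second difference of \<open>f\<close>; this suffices because \<open>q \<ge> 2\<close>.
\<close>

section \<open>Invariance of the area measure under rotations\<close>

text \<open>Lebesgue measure is determined by its values on boxes. The preimage of a box is its
  image under the inverse, which is again orthogonal, and a linear image scales measure by the
  absolute determinant, here 1.\<close>

lemma lborel_distr_orthogonal_transformation:
  fixes f :: "real^'n::{finite,wellorder} \<Rightarrow> real^'n::_"
  assumes f: "orthogonal_transformation f"
  shows "distr lborel borel f = lborel"
proof (rule lborel_eqI[symmetric])
  have lin: "linear f" and bij: "bij f"
    using f by (auto simp: orthogonal_transformation_linear orthogonal_transformation_bij)
  have meas [measurable]: "f \<in> borel_measurable borel"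
    by (simp add: lin borel_measurable_continuous_onI linear_continuous_on linear_conv_bounded_linear[symmetric])
  define g where "g = inv f"
  have g: "orthogonal_transformation g"
    unfolding g_def by (simp add: f orthogonal_transformation_inv)
  fix l u :: "real^'n::_" assume le: "\<And>b. b \<in> Basis \<Longrightarrow> l \<bullet> b \<le> u \<bullet> b"
  have vimage: "f -` box l u = g ` box l u"
    unfolding g_def by (simp add: bij bij_vimage_eq_inv_image)
  have "emeasure (distr lborel borel f) (box l u) = emeasure lborel (f -` box l u)"
    by (simp add: emeasure_distr)
  also have "\<dots> = emeasure lebesgue (g ` box l u)"
    unfolding vimage[symmetric] using measurable_sets[OF meas, of "box l u"] by simp
  also have "\<dots> = ennreal (measure lebesgue (g ` box l u))"
    using measurable_linear_image[OF orthogonal_transformation_linear[OF g] lmeasurable_box, of l u]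
    by (intro emeasure_eq_ennreal_measure) (metis fmeasurableD2 infinity_ennreal_def)
  also have "measure lebesgue (g ` box l u) = measure lebesgue (box l u)"
    using g by (subst measure_linear_image) (auto simp: orthogonal_transformation_linear)
  also have "ennreal (measure lebesgue (box l u)) = emeasure lborel (box l u)"
    by (simp add: emeasure_lborel_box_eq measure_lborel_box_eq)
  also have "\<dots> = (\<Prod>b\<in>Basis. (u - l) \<bullet> b)"
    using le by (simp add: emeasure_lborel_box)
  finally show "emeasure (distr lborel borel f) (box l u) = (\<Prod>b\<in>Basis. (u - l) \<bullet> b)" .
qed simp

text \<open>Identifies the plane with \<open>real^2\<close>, where determinants are available: the
  coordinate map pulls a box back to a box with the same side lengths.\<close>

lemma lborel_complex_eq_distr:
  "lborel = distr (lborel :: (real^2) measure) borel (\<lambda>x. Complex (x $ 1) (x $ 2))"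
proof (rule lborel_eqI)
  have [measurable]: "(\<lambda>x::real^2. Complex (x $ 1) (x $ 2)) \<in> borel_measurable borel"
    unfolding Complex_eq by (intro borel_measurable_continuous_onI continuous_intros)
  fix l u :: complex assume le: "\<And>b. b \<in> Basis \<Longrightarrow> l \<bullet> b \<le> u \<bullet> b"
  let ?L = "vector [Re l, Im l] :: real^2" and ?U = "vector [Re u, Im u] :: real^2"
  have B: "(Basis :: (real^2) set) = {axis 1 1, axis 2 1}"
    by (auto simp: Basis_vec_def) (metis exhaust_2)
  have "(\<lambda>x::real^2. Complex (x $ 1) (x $ 2)) -` box l u = box ?L ?U"
    by (auto simp: box_def Basis_complex_def B inner_axis)
  then have "emeasure (distr lborel borel (\<lambda>x::real^2. Complex (x $ 1) (x $ 2))) (box l u)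
      = emeasure lborel (box ?L ?U)"
    by (simp add: emeasure_distr)
  also have "\<dots> = (\<Prod>b\<in>Basis. (?U - ?L) \<bullet> b)"
    using le[of 1] le[of \<i>] by (intro emeasure_lborel_box) (auto simp: Basis_complex_def B inner_axis)
  also have "(\<Prod>b\<in>Basis. (?U - ?L) \<bullet> b) = (\<Prod>b\<in>Basis. (u - l) \<bullet> b)"
  proof -
    show ?thesis
      unfolding B by (simp add: Basis_complex_def axis_eq_axis inner_axis vector_2)
  qed
  finally show "emeasure (distr lborel borel (\<lambda>x::real^2. Complex (x $ 1) (x $ 2))) (box l u)
      = (\<Prod>b\<in>Basis. (u - l) \<bullet> b)" .
qed simp

lemma lborel_distr_mult_unimodular:
  fixes \<alpha> :: complex
  assumes \<alpha>: "norm \<alpha> = 1"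
  shows "distr lborel borel ((*) \<alpha>) = lborel"
proof -
  define \<psi> where "\<psi> = (\<lambda>x::real^2. Complex (x $ 1) (x $ 2))"
  define f :: "real^2 \<Rightarrow> real^2" where
    "f = (\<lambda>x. vector [Re (\<alpha> * \<psi> x), Im (\<alpha> * \<psi> x)])"
  have \<psi>: "lborel = distr lborel borel \<psi>"
    unfolding \<psi>_def by (rule lborel_complex_eq_distr)
  have [measurable]: "\<psi> \<in> borel_measurable borel"
    unfolding \<psi>_def Complex_eq by (intro borel_measurable_continuous_onI continuous_intros)
  have [measurable]: "(*) \<alpha> \<in> borel_measurable borel"
    by (intro borel_measurable_continuous_onI continuous_intros)
  have "linear f"
    by (rule linearI) (auto simp: f_def \<psi>_def vec_eq_iff forall_2 vector_2 algebra_simps)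
  moreover have "norm (f x) = norm x" for x
  proof -
    have "norm (f x) = norm (\<alpha> * \<psi> x)"
      by (simp add: f_def norm_vec_def L2_set_def sum_2 vector_2 cmod_def del: complex_mult_cnj)
    also have "\<dots> = norm x"
      using \<alpha> by (simp add: norm_mult) (simp add: \<psi>_def norm_vec_def L2_set_def sum_2 cmod_def)
    finally show ?thesis .
  qed
  ultimately have f: "orthogonal_transformation f"
    by (simp add: orthogonal_transformation)
  have [measurable]: "f \<in> borel_measurable borel"
    by (simp add: \<open>linear f\<close> borel_measurable_continuous_onI linear_continuous_on linear_conv_bounded_linear[symmetric])
  \<comment> \<open>\<open>f\<close> is multiplication by \<alpha> read in coordinates, so its
    invariance transfers along \<psi>.\<close>
  have comm: "(*) \<alpha> \<circ> \<psi> = \<psi> \<circ> f"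
    by (auto simp: fun_eq_iff f_def vector_2 \<psi>_def complex_eq_iff)
  have "distr lborel borel ((*) \<alpha>) = distr lborel borel ((*) \<alpha> \<circ> \<psi>)"
    by (subst \<psi>) (simp add: distr_distr)
  also have "\<dots> = distr (distr lborel borel f) borel \<psi>"
    unfolding comm by (simp add: distr_distr)
  also have "\<dots> = lborel"
    using f by (simp add: lborel_distr_orthogonal_transformation \<psi>[symmetric])
  finally show ?thesis .
qed

text \<open>Passage from Borel sets to the completion: preservation of the Borel measure implies
  that preimages of null sets are null, which yields measurability for the completed
  measure.\<close>

lemma lebesgue_distr_mult_unimodular:
  fixes \<alpha> :: complex
  assumes \<alpha>: "norm \<alpha> = 1"
  shows "(*) \<alpha> \<in> lebesgue \<rightarrow>\<^sub>M lebesgue" and "distr lebesgue lebesgue ((*) \<alpha>) = lebesgue"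
proof -
  have meas: "(*) \<alpha> \<in> lborel \<rightarrow>\<^sub>M lborel"
    by simp
  have eq: "distr lborel lborel ((*) \<alpha>) = lborel"
    using lborel_distr_mult_unimodular[OF \<alpha>] by (simp cong: distr_cong)
  have compl: "distr lebesgue lborel ((*) \<alpha>) = lborel"
    using distr_completion[OF meas] eq by simp
  show "(*) \<alpha> \<in> lebesgue \<rightarrow>\<^sub>M lebesgue"
    by (rule completion.measurable_completion2) (use meas in \<open>auto simp: measurable_completion compl\<close>)
  show "distr lebesgue lebesgue ((*) \<alpha>) = lebesgue"
    using completion.completion_distr_eq[of "(*) \<alpha>" lborel lborel] meas compl
    by (simp add: measurable_completion)
qed

lemma disk_area_distr_mult_unimodular:
  fixes \<alpha> :: complex
  assumes \<alpha>: "norm \<alpha> = 1"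
  shows "(*) \<alpha> \<in> disk_area \<rightarrow>\<^sub>M disk_area" and "distr disk_area disk_area ((*) \<alpha>) = disk_area"
proof -
  note leb = lebesgue_distr_mult_unimodular[OF \<alpha>]
  have vimage: "(*) \<alpha> -` ball 0 1 = ball 0 1"
    using \<alpha> by (auto simp: norm_mult)
  have restr: "(*) \<alpha> \<in> lebesgue_on (ball 0 1) \<rightarrow>\<^sub>M lebesgue_on (ball 0 1)"
    using \<alpha> by (intro measurable_restrict_space3 leb(1)) (auto simp: norm_mult)
  then show meas: "(*) \<alpha> \<in> disk_area \<rightarrow>\<^sub>M disk_area"
    by (simp add: disk_area_def cong: measurable_cong_sets)
  show "distr disk_area disk_area ((*) \<alpha>) = disk_area"
  proof (rule measure_eqI)
    fix A assume "A \<in> sets (distr disk_area disk_area ((*) \<alpha>))"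
    then have A: "A \<in> sets disk_area" by simp
    then have A': "A \<subseteq> ball 0 1" "A \<in> sets lebesgue"
      by (auto simp: disk_area_def sets_restrict_space_iff)
    have sub: "(*) \<alpha> -` A \<subseteq> ball 0 1"
      using A'(1) vimage by blast
    have leb_vimage: "(*) \<alpha> -` A \<in> sets lebesgue"
      using measurable_sets[OF leb(1) A'(2)] by simp
    have "emeasure lebesgue ((*) \<alpha> -` A) = emeasure lebesgue A"
      using emeasure_distr[OF leb(1) A'(2)] by (simp add: leb(2))
    then have "emeasure disk_area ((*) \<alpha> -` A) = emeasure disk_area A"
      using A' sub leb_vimage by (simp add: disk_area_def emeasure_restrict_space)
    moreover have "(*) \<alpha> -` A \<inter> space disk_area = (*) \<alpha> -` A"
      using sub by (auto simp: disk_area_def space_scale_measure)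
    ultimately show "emeasure (distr disk_area disk_area ((*) \<alpha>)) A = emeasure disk_area A"
      using A meas by (simp add: emeasure_distr)
  qed simp
qed

section \<open>Quantitative convexity of powers of the norm\<close>

text \<open>Taylor expansion of order two at \<open>y\<close>. Since p \<le> 2, the second
  derivative is nonincreasing on the positive axis, and the intermediate point is at most
  \<open>x + y\<close>, so evaluating there bounds the remainder from below.\<close>

lemma powr_taylor_lower_bound:
  fixes p x y :: real
  assumes p: "1 < p" "p \<le> 2" and x: "0 \<le> x" and y: "0 < y"
  shows "y powr p + p * y powr (p - 1) * (x - y) + p * (p - 1) / 2 * (x + y) powr (p - 2) * (x - y)\<^sup>2
    \<le> x powr p"
proof (cases "x = 0 \<or> x = y")
  \<comment> \<open>At \<open>x = 0\<close> the derivatives are singular, so this endpoint is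
    checked by hand: the claim becomes
    \<open>y powr p * ((p - 1) * (p / 2 - 1)) \<le> 0\<close>.\<close>
  case True
  have "y powr (p - 1) * y = y powr p" "y powr (p - 2) * y\<^sup>2 = y powr p"
    using y by (simp_all add: powr_diff powr_numeral)
  moreover have "y powr p * ((p - 1) * (p / 2 - 1)) \<le> 0"
    using p by (intro mult_nonneg_nonpos) (auto intro: mult_nonneg_nonpos)
  ultimately show ?thesis
    using True p by (auto simp: algebra_simps power2_eq_square)
next
  case False
  with x have x0: "0 < x" and "x \<noteq> y" by auto
  define D where "D = (\<lambda>m::nat. if m = 0 then (\<lambda>s. s powr p) else if m = 1 then (\<lambda>s. p * s powr (p - 1))
    else (\<lambda>s. p * (p - 1) * s powr (p - 2)))"
  have der: "DERIV (D m) s :> D (Suc m) s" if "m < 2" "min x y \<le> s" "s \<le> max x y" for m s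
  proof -
    have "0 < s" using that x0 y by auto
    moreover have "m = 0 \<or> m = 1" using that by auto
    ultimately show ?thesis
      by (auto simp: D_def intro!: derivative_eq_intros)
  qed
  obtain s where *: "if x < y then x < s \<and> s < y else y < s \<and> s < x"
    and eq: "x powr p = (\<Sum>m<2. D m y / fact m * (x - y) ^ m) + D 2 s / fact 2 * (x - y) ^ 2"
    using Taylor[of 2 D "\<lambda>s. s powr p" "min x y" "max x y" y x] der \<open>x \<noteq> y\<close>
    by (auto simp: D_def)
  from * have s: "0 < s" "s \<le> x + y"
    using x0 y by (auto split: if_splits)
  have "(x + y) powr (p - 2) \<le> s powr (p - 2)"
    using s p by (intro powr_mono2') auto
  then have "p * (p - 1) / 2 * (x + y) powr (p - 2) * (x - y)\<^sup>2 \<le> p * (p - 1) / 2 * s powr (p - 2) * (x - y)\<^sup>2"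
    using p by (intro mult_right_mono mult_left_mono) auto
  with eq show ?thesis
    by (simp add: D_def numeral_2_eq_2)
qed

text \<open>Reduces to the scalar bound for \<open>x = norm a\<close>, \<open>y = norm m\<close>.
  With \<open>D\<close> the squared distance, the surplus of \<open>D\<close> over
  \<open>(x - y)\<^sup>2\<close> enters negatively through the inner product and positively through
  the quadratic term; the negative coefficient dominates.\<close>

lemma norm_powr_taylor_lower_bound:
  fixes a m :: "'a::real_inner" and p :: real
  assumes p: "1 < p" "p \<le> 2"
  shows "norm m powr p + p * norm m powr (p - 2) * (m \<bullet> (a - m))
      + p * (p - 1) / 2 * (norm a + norm m) powr (p - 2) * (norm (a - m))\<^sup>2 \<le> norm a powr p"
proof (cases "m = 0")
  case True
  have *: "norm a powr (p - 2) * (norm a)\<^sup>2 = norm a powr p"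
    by (cases "a = 0") (simp_all add: powr_diff powr_numeral)
  \<comment> \<open>The product equals \<open>2 - p * (p - 1)\<close>, which is why the quadratic
    coefficient is at most 1.\<close>
  have "0 \<le> (2 - p) * (p + 1)"
    using p by (intro mult_nonneg_nonneg) auto
  then have "p * (p - 1) / 2 \<le> 1"
    by (simp add: algebra_simps)
  then have "p * (p - 1) / 2 * (norm a powr p) \<le> 1 * (norm a powr p)"
    by (intro mult_right_mono) auto
  with * True p show ?thesis
    by (simp add: mult.assoc)
next
  case False
  define x y r D where "x = norm a" and "y = norm m" and "r = m \<bullet> (a - m)" and "D = (norm (a - m))\<^sup>2"
  have y: "0 < y" and x: "0 \<le> x"
    using False by (simp_all add: x_def y_def)
  have r: "r = (x\<^sup>2 - y\<^sup>2 - D) / 2"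
    by (simp add: r_def x_def y_def D_def power2_norm_eq_inner inner_diff inner_commute)
  have "\<bar>x - y\<bar> \<le> norm (a - m)"
    by (simp add: x_def y_def norm_triangle_ineq3)
  then have D: "(x - y)\<^sup>2 \<le> D"
    unfolding D_def by (metis abs_le_square_iff abs_norm_cancel)
  have yp: "y powr (p - 1) = y powr (p - 2) * y"
    using y by (simp add: powr_diff powr_numeral power2_eq_square)
  have "(x + y) powr (p - 2) \<le> y powr (p - 2)"
    using x y p by (intro powr_mono2') auto
  then have "(p - 1) * (x + y) powr (p - 2) \<le> 1 * y powr (p - 2)"
    using p by (intro mult_mono) auto
  then have "0 \<le> p / 2 * (y powr (p - 2) - (p - 1) * (x + y) powr (p - 2)) * (D - (x - y)\<^sup>2)"
    using p D by (intro mult_nonneg_nonneg) auto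
  \<comment> \<open>The identity rests on
    \<open>x\<^sup>2 - y\<^sup>2 = 2 * y * (x - y) + (x - y)\<^sup>2\<close>.\<close>
  moreover have "p * y powr (p - 2) * r + p * (p - 1) / 2 * (x + y) powr (p - 2) * D
      = p * y powr (p - 1) * (x - y) + p * (p - 1) / 2 * (x + y) powr (p - 2) * (x - y)\<^sup>2
        - p / 2 * (y powr (p - 2) - (p - 1) * (x + y) powr (p - 2)) * (D - (x - y)\<^sup>2)"
    unfolding r yp by (simp add: field_simps power2_eq_square)
  moreover note powr_taylor_lower_bound[OF p x y]
  ultimately have "y powr p + p * y powr (p - 2) * r + p * (p - 1) / 2 * (x + y) powr (p - 2) * D
      \<le> x powr p"
    by linarith
  then show ?thesis
    by (simp add: x_def y_def r_def D_def)
qed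

text \<open>Expand around the midpoint \<open>m\<close> towards \<open>a\<close> and towards
  \<open>b\<close>: the two first-order terms cancel and the quadratic remainders add up.\<close>

lemma norm_powr_midpoint_convexity:
  fixes a b :: "'a::real_inner" and p :: real
  assumes p: "1 < p" "p \<le> 2"
  shows "p * (p - 1) / 8 * (norm a + norm b) powr (p - 2) * (norm (a - b))\<^sup>2
    \<le> norm a powr p + norm b powr p - 2 * norm ((a + b) /\<^sub>R 2) powr p"
proof (cases "a = 0 \<and> b = 0")
  case False
  define m S where "m = (a + b) /\<^sub>R 2" and "S = norm a + norm b"
  have S: "0 < S"
    using False by (auto simp: S_def add_nonneg_pos add_pos_nonneg)
  have h: "a - m = (a - b) /\<^sub>R 2" "b - m = - ((a - b) /\<^sub>R 2)"
    by (simp_all add: m_def algebra_simps scaleR_2 flip: scaleR_add_left)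
  have m: "2 * norm m \<le> S"
    unfolding m_def S_def using norm_triangle_ineq[of a b] by simp
  have "a = 2 *\<^sub>R m - b" "b = 2 *\<^sub>R m - a"
    by (simp_all add: m_def)
  \<comment> \<open>Positive bases are needed because \<open>0 powr r\<close> is 0, so powers with
    negative exponent are not antitone at 0.\<close>
  then have "a \<noteq> 0 \<or> m \<noteq> 0" "b \<noteq> 0 \<or> m \<noteq> 0"
    using False by auto
  then have pos: "0 < norm a + norm m" "0 < norm b + norm m"
    by (auto simp: add_nonneg_pos add_pos_nonneg)
  \<comment> \<open>Both \<open>norm a + norm m\<close> and \<open>norm b + norm m\<close> are at
    most \<open>2 * S\<close>, so \<open>k\<close> is a common lower bound for their powers.
    Extracting the 2 costs a factor 1/2, as p - 2 \<ge> -1; with the 1/4 from halving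
    \<open>a - b\<close> this gives the constant 1/8.\<close>
  define k where "k = (2 * S) powr (p - 2)"
  have k: "k \<le> (norm a + norm m) powr (p - 2)" "k \<le> (norm b + norm m) powr (p - 2)"
    unfolding k_def using m S p pos by (auto simp: S_def intro!: powr_mono2')
  have "2 powr (-1) \<le> (2 powr (p - 2) :: real)"
    using p by (intro powr_mono) auto
  then have "1 / 2 * S powr (p - 2) \<le> k"
    using S by (simp add: k_def powr_mult powr_minus)
  then have "p * (p - 1) / 8 * (S powr (p - 2) * (norm (a - b))\<^sup>2)
      \<le> p * (p - 1) / 8 * (2 * k * (norm (a - b))\<^sup>2)"
    using p by (intro mult_left_mono mult_right_mono) auto
  then have low: "p * (p - 1) / 8 * S powr (p - 2) * (norm (a - b))\<^sup>2
      \<le> 2 * (p * (p - 1) / 2 * k * ((norm (a - b))\<^sup>2 / 4))"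
    by (simp add: mult_ac)
  have *: "p * (p - 1) / 2 * k * ((norm (a - b))\<^sup>2 / 4)
      \<le> p * (p - 1) / 2 * c * ((norm (a - b))\<^sup>2 / 4)" if "k \<le> c" for c
    using p that by (intro mult_right_mono mult_left_mono) auto
  have na: "(norm (a - m))\<^sup>2 = (norm (a - b))\<^sup>2 / 4" "(norm (b - m))\<^sup>2 = (norm (a - b))\<^sup>2 / 4"
    unfolding h by (simp_all add: power_divide)
  have inn: "p * norm m powr (p - 2) * (m \<bullet> (b - m)) = - (p * norm m powr (p - 2) * (m \<bullet> (a - m)))"
    unfolding h by simp
  show ?thesis
    using norm_powr_taylor_lower_bound[OF p, of m a] norm_powr_taylor_lower_bound[OF p, of m b]
      *[OF k(1)] *[OF k(2)] low
    unfolding na inn m_def[symmetric] S_def[symmetric] by linarith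
qed simp

text \<open>
  Distinguishing whether \<open>\<bar>a - b\<bar>\<close> is at most \<open>\<delta>\<close> times \<open>\<bar>a\<bar> + \<bar>b\<bar>\<close> gives a pointwise inequality that can
  be integrated directly, in place of Hoelder's inequality; \<open>\<delta>\<close> is optimized after integration.
\<close>
lemma norm_diff_powr_le:
  fixes a b :: "'a::real_inner" and p \<delta> :: real
  assumes p: "1 < p" "p \<le> 2" and \<delta>: "0 < \<delta>"
  shows "norm (a - b) powr p \<le> 4 * \<delta> powr p * (norm a powr p + norm b powr p)
    + 8 / (p * (p - 1)) * \<delta> powr (p - 2)
      * (norm a powr p + norm b powr p - 2 * norm ((a + b) /\<^sub>R 2) powr p)"
proof -
  define S h E where "S = norm a + norm b" and "h = norm (a - b)"
    and "E = norm a powr p + norm b powr p - 2 * norm ((a + b) /\<^sub>R 2) powr p"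
  have nonneg: "0 \<le> S" "0 \<le> h"
    by (simp_all add: S_def h_def)
  have "p * (p - 1) / 8 * (S powr (p - 2) * h\<^sup>2) \<le> E"
    using norm_powr_midpoint_convexity[OF p, of a b] by (simp add: S_def h_def E_def mult.assoc)
  then have E: "S powr (p - 2) * h\<^sup>2 \<le> 8 / (p * (p - 1)) * E"
    using p by (simp add: field_simps)
  have Sp: "S powr p \<le> 4 * (norm a powr p + norm b powr p)"
  proof -
    have "S powr p \<le> (2 * max (norm a) (norm b)) powr p"
      using p by (intro powr_mono2) (auto simp: S_def)
    also have "\<dots> = 2 powr p * max (norm a) (norm b) powr p"
      by (simp add: powr_mult)
    also have "\<dots> \<le> 2 powr 2 * (norm a powr p + norm b powr p)"
      using p by (intro mult_mono powr_mono) (auto simp: max_def)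
    finally show ?thesis by simp
  qed
  have "h powr p \<le> \<delta> powr p * S powr p + \<delta> powr (p - 2) * (S powr (p - 2) * h\<^sup>2)"
  proof (cases "h \<le> \<delta> * S")
    case True
    then have "h powr p \<le> (\<delta> * S) powr p"
      using p nonneg by (intro powr_mono2) auto
    then show ?thesis
      using \<delta> nonneg by (simp add: powr_mult add_increasing2)
  next
    case False
    have S: "0 < S"
    proof (rule ccontr)
      assume "\<not> 0 < S"
      then have "norm a = 0 \<and> norm b = 0"
        using norm_ge_zero[of a] norm_ge_zero[of b] unfolding S_def by linarith
      with False \<delta> show False by (simp add: S_def h_def)
    qed
    with False \<delta> have h: "0 < h"
      by (smt (verit) mult_pos_pos)
    \<comment> \<open>As p - 2 \<le> 0, replacing \<open>h\<close> by the smaller \<delta> S in the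
      first factor increases it.\<close>
    have "h powr p = h powr (p - 2) * h\<^sup>2"
      using h by (simp add: powr_diff powr_numeral)
    also have "\<dots> \<le> (\<delta> * S) powr (p - 2) * h\<^sup>2"
      using False \<delta> S p by (intro mult_right_mono powr_mono2') auto
    also have "\<dots> = \<delta> powr (p - 2) * (S powr (p - 2) * h\<^sup>2)"
      using \<delta> S by (simp add: powr_mult)
    finally show ?thesis
      by (simp add: add_increasing)
  qed
  also have "\<dots> \<le> \<delta> powr p * (4 * (norm a powr p + norm b powr p))
      + \<delta> powr (p - 2) * (8 / (p * (p - 1)) * E)"
    using Sp E by (intro add_mono mult_left_mono) auto
  finally show ?thesis
    unfolding h_def E_def by (simp only: mult_ac)
qed

section \<open>Lebesgue and Bergman spaces of the disk\<close>

lemma powr_le_self: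
  fixes s p :: real
  assumes "0 \<le> s" "s \<le> 1" "1 \<le> p"
  shows "s powr p \<le> s"
  using assms by (cases "s = 0") (use powr_mono'[of 1 p s] in auto)

text \<open>Pointwise source of Minkowski's inequality: convexity of the power at
  \<open>x / A\<close> and \<open>y / B\<close> with weights proportional to \<open>A\<close> and
  \<open>B\<close>.\<close>

lemma weighted_powr_add_le:
  fixes x y A B p :: real
  assumes p: "1 \<le> p" and xy: "0 \<le> x" "0 \<le> y" and AB: "0 < A" "0 < B"
  shows "((x + y) / (A + B)) powr p
    \<le> A / (A + B) * (x / A) powr p + B / (A + B) * (y / B) powr p"
proof -
  \<comment> \<open>Convexity is applied at positive arguments only. If \<open>x\<close> or
    \<open>y\<close> vanishes, the bound follows from \<open>s powr p \<le> s\<close> on the unit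
    interval.\<close>
  have zero: "(z / (A + B)) powr p \<le> D / (A + B) * (z / D) powr p"
    if "0 \<le> z" "0 < D" "D \<le> A + B" for z D
  proof -
    have "(z / (A + B)) powr p = (D / (A + B)) powr p * (z / D) powr p"
      using that AB by (simp flip: powr_mult)
    also have "\<dots> \<le> D / (A + B) * (z / D) powr p"
      using that AB p by (intro mult_right_mono powr_le_self) auto
    finally show ?thesis .
  qed
  show ?thesis
  proof (cases "x = 0 \<or> y = 0")
    case True
    then show ?thesis
      using zero[of x A] zero[of y B] xy AB by auto
  next
    case False
    have sum: "1 - B / (A + B) = A / (A + B)" and "B / (A + B) \<le> 1"
      using AB by (simp_all add: divide_simps)
    have "(x + y) / (A + B) = A / (A + B) * (x / A) + B / (A + B) * (y / B)"
      using AB by (simp add: divide_simps)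
    moreover have "0 < x / A" "0 < y / B"
      using False xy AB by auto
    ultimately show ?thesis
      using convex_onD[OF powr_convex[OF p], of "B / (A + B)" "x / A" "y / B"] AB \<open>B / (A + B) \<le> 1\<close>
      unfolding sum by simp
  qed
qed

lemma Lp_disk_measurable: "u \<in> Lp_disk p \<Longrightarrow> u \<in> borel_measurable disk_area"
  and Lp_disk_integrable: "u \<in> Lp_disk p \<Longrightarrow> integrable disk_area (\<lambda>z. norm (u z) powr p)"
  by (simp_all add: Lp_disk_def)

lemma Lp_disk_add:
  assumes p: "1 \<le> p" and u: "u \<in> Lp_disk p" and v: "v \<in> Lp_disk p"
  shows "(\<lambda>z. u z + v z) \<in> Lp_disk p"
proof -
  note [measurable] = Lp_disk_measurable[OF u] Lp_disk_measurable[OF v]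
  have "norm (u z + v z) powr p \<le> 2 powr p * (norm (u z) powr p + norm (v z) powr p)" for z
  proof -
    have "norm (u z + v z) powr p = 2 powr p * (norm (u z + v z) / 2) powr p"
      by (simp add: powr_divide)
    also have "\<dots> \<le> 2 powr p * ((norm (u z) + norm (v z)) / 2) powr p"
      using p by (intro mult_left_mono powr_mono2 divide_right_mono norm_triangle_ineq) auto
    also have "\<dots> \<le> 2 powr p * (1 / 2 * norm (u z) powr p + 1 / 2 * norm (v z) powr p)"
      using weighted_powr_add_le[OF p, of "norm (u z)" "norm (v z)" 1 1]
      by (intro mult_left_mono) auto
    also have "\<dots> \<le> 2 powr p * (norm (u z) powr p + norm (v z) powr p)"
      by (intro mult_left_mono add_mono) auto
    finally show ?thesis .
  qed
  then have "integrable disk_area (\<lambda>z. norm (u z + v z) powr p)"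
    by (intro Bochner_Integration.integrable_bound[OF integrable_mult_right[OF
          Bochner_Integration.integrable_add[OF Lp_disk_integrable[OF u] Lp_disk_integrable[OF v]], of "2 powr p"]]) auto
  then show ?thesis
    by (simp add: Lp_disk_def)
qed

lemma Lp_disk_cmult:
  assumes u: "u \<in> Lp_disk p"
  shows "(\<lambda>z. c * u z) \<in> Lp_disk p"
proof -
  note [measurable] = Lp_disk_measurable[OF u]
  have "(\<lambda>z. c * u z) \<in> borel_measurable disk_area"
    by measurable
  then show ?thesis
    using u by (simp add: Lp_disk_def norm_mult powr_mult)
qed

lemma Lp_disk_diff:
  assumes p: "1 \<le> p" and u: "u \<in> Lp_disk p" and v: "v \<in> Lp_disk p"
  shows "(\<lambda>z. u z - v z) \<in> Lp_disk p"
  using Lp_disk_add[OF p u Lp_disk_cmult[OF v, of "-1"]] by simp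

lemma Lp_norm_nonneg: "0 \<le> Lp_norm p u"
  by (simp add: Lp_norm_def)

lemma Lp_norm_powr:
  assumes "0 < p"
  shows "Lp_norm p u powr p = (LINT z|disk_area. norm (u z) powr p)"
  using assms by (simp add: Lp_norm_def powr_powr)

lemma Lp_norm_le_iff:
  assumes "0 < p" "0 \<le> c"
  shows "Lp_norm p u \<le> c \<longleftrightarrow> (LINT z|disk_area. norm (u z) powr p) \<le> c powr p"
  unfolding Lp_norm_powr[OF assms(1), symmetric]
  using assms Lp_norm_nonneg[of p u] powr_mono2[of p "Lp_norm p u" c] powr_less_mono2[of p c "Lp_norm p u"]
  by fastforce

lemma Lp_norm_cmult:
  assumes "0 < p"
  shows "Lp_norm p (\<lambda>z. c * u z) = norm c * Lp_norm p u"
  using assms by (simp add: Lp_norm_def norm_mult powr_mult powr_powr)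

lemma Lp_norm_triangle:
  assumes p: "1 \<le> p" and u: "u \<in> Lp_disk p" and v: "v \<in> Lp_disk p"
  shows "Lp_norm p (\<lambda>z. u z + v z) \<le> Lp_norm p u + Lp_norm p v"
proof (rule field_le_epsilon)
  fix e :: real assume e: "0 < e"
  \<comment> \<open>The summand \<open>e / 2\<close> makes both divisors positive even if a norm
    vanishes; the normalized integrals are then at most 1, and the weights sum to 1.\<close>
  define A B where "A = Lp_norm p u + e / 2" and "B = Lp_norm p v + e / 2"
  have AB: "0 < A" "0 < B"
    using e Lp_norm_nonneg[of p u] Lp_norm_nonneg[of p v] by (auto simp: A_def B_def)
  have le1: "(LINT z|disk_area. norm (w z) powr p) / D powr p \<le> 1" if "0 < D" "Lp_norm p w \<le> D" for w D
    using that p Lp_norm_le_iff[of p D w] by simp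
  note int = Lp_disk_integrable[OF u] Lp_disk_integrable[OF v]
    Lp_disk_integrable[OF Lp_disk_add[OF p u v]]
  have "(LINT z|disk_area. norm (u z + v z) powr p) / (A + B) powr p
      = (LINT z|disk_area. norm (u z + v z) powr p / (A + B) powr p)"
    by simp
  also have "\<dots> \<le> (LINT z|disk_area. A / (A + B) * (norm (u z) powr p / A powr p)
      + B / (A + B) * (norm (v z) powr p / B powr p))"
  proof (rule integral_mono)
    fix z
    have "norm (u z + v z) powr p / (A + B) powr p \<le> ((norm (u z) + norm (v z)) / (A + B)) powr p"
      using AB p by (simp add: powr_divide divide_right_mono powr_mono2 norm_triangle_ineq)
    also have "\<dots> \<le> A / (A + B) * (norm (u z) / A) powr p + B / (A + B) * (norm (v z) / B) powr p"
      by (rule weighted_powr_add_le) (use p AB in auto)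
    finally show "norm (u z + v z) powr p / (A + B) powr p
      \<le> A / (A + B) * (norm (u z) powr p / A powr p) + B / (A + B) * (norm (v z) powr p / B powr p)"
      using AB by (simp add: powr_divide)
  qed (use int in auto)
  also have "\<dots> = A / (A + B) * ((LINT z|disk_area. norm (u z) powr p) / A powr p)
      + B / (A + B) * ((LINT z|disk_area. norm (v z) powr p) / B powr p)"
    using int by simp
  also have "\<dots> \<le> A / (A + B) * 1 + B / (A + B) * 1"
    using AB e by (intro add_mono mult_left_mono le1) (auto simp: A_def B_def)
  also have "\<dots> = 1"
    using AB by (simp add: divide_simps)
  finally have "Lp_norm p (\<lambda>z. u z + v z) \<le> A + B"
    using AB p by (subst Lp_norm_le_iff) (auto simp: divide_simps)
  then show "Lp_norm p (\<lambda>z. u z + v z) \<le> Lp_norm p u + Lp_norm p v + e"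
    by (simp add: A_def B_def)
qed

section \<open>Rotations as isometries of the Lebesgue and Bergman spaces\<close>

lemma rotation_in_Lp_disk:
  assumes "norm \<alpha> = 1" and u: "u \<in> Lp_disk p"
  shows "rotation \<alpha> u \<in> Lp_disk p"
  using measurable_compose[OF disk_area_distr_mult_unimodular(1)[OF assms(1)] Lp_disk_measurable[OF u]]
    integrable_distr[OF disk_area_distr_mult_unimodular(1)[OF assms(1)], of "\<lambda>z. norm (u z) powr p"]
    Lp_disk_integrable[OF u]
  by (simp add: Lp_disk_def rotation_def disk_area_distr_mult_unimodular(2)[OF assms(1)])

lemma Lp_norm_rotation:
  assumes "norm \<alpha> = 1" and u: "u \<in> Lp_disk p"
  shows "Lp_norm p (rotation \<alpha> u) = Lp_norm p u"
proof -
  have [measurable]: "(\<lambda>z. norm (u z) powr p) \<in> borel_measurable disk_area"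
    using Lp_disk_integrable[OF u] by simp
  show ?thesis
    using integral_distr[OF disk_area_distr_mult_unimodular(1)[OF assms(1)], of "\<lambda>z. norm (u z) powr p"]
    by (simp add: Lp_norm_def rotation_def disk_area_distr_mult_unimodular(2)[OF assms(1)])
qed

lemma rotation_in_bergman_space:
  assumes \<alpha>: "norm \<alpha> = 1" and f: "f \<in> bergman_space p"
  shows "rotation \<alpha> f \<in> bergman_space p"
proof -
  have "f analytic_on (*) \<alpha> ` ball 0 1"
    using f \<alpha> by (auto simp: bergman_space_def norm_mult intro: analytic_on_subset)
  then have "f \<circ> (*) \<alpha> analytic_on ball 0 1"
    by (intro analytic_on_compose analytic_on_linear)
  then show ?thesis
    using f rotation_in_Lp_disk[OF \<alpha>, of f p] by (simp add: bergman_space_def rotation_def o_def)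
qed

lemma bergman_space_add:
  assumes "1 \<le> p" "f \<in> bergman_space p" "g \<in> bergman_space p"
  shows "(\<lambda>z. f z + g z) \<in> bergman_space p"
  using assms by (auto simp: bergman_space_def intro: analytic_on_add Lp_disk_add)

lemma bergman_space_cmult:
  assumes "f \<in> bergman_space p"
  shows "(\<lambda>z. c * f z) \<in> bergman_space p"
  using assms by (auto simp: bergman_space_def intro: analytic_on_mult Lp_disk_cmult)

section \<open>Minimality and uniform convexity in norm form\<close>

lemma best_approximant_norm_le:
  assumes "is_best_approximant p \<omega> f" and "g \<in> bergman_space p"
  shows "Lp_norm p (\<lambda>z. \<omega> z - f z) \<le> Lp_norm p (\<lambda>z. \<omega> z - g z)"
  using assms unfolding is_best_approximant_def
  by (auto intro!: cINF_lower bdd_belowI2[where m = 0] Lp_norm_nonneg)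

text \<open>Integral of the pointwise inequality. The free \<delta> can be matched to the size of
  the midpoint deficit.\<close>

lemma Lp_norm_diff_powr_le:
  assumes p: "1 < p" "p \<le> 2" and \<delta>: "0 < \<delta>" and u: "u \<in> Lp_disk p" and v: "v \<in> Lp_disk p"
  shows "Lp_norm p (\<lambda>z. u z - v z) powr p \<le> 4 * \<delta> powr p * (Lp_norm p u powr p + Lp_norm p v powr p)
    + 8 / (p * (p - 1)) * \<delta> powr (p - 2)
      * (Lp_norm p u powr p + Lp_norm p v powr p - 2 * Lp_norm p (\<lambda>z. 1 / 2 * (u z + v z)) powr p)"
proof -
  have p0: "0 < p" "1 \<le> p" using p by auto
  note int = Lp_disk_integrable[OF u] Lp_disk_integrable[OF v]
    Lp_disk_integrable[OF Lp_disk_cmult[OF Lp_disk_add[OF p0(2) u v], of "1 / 2"]]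
  have "(LINT z|disk_area. norm (u z - v z) powr p)
    \<le> (LINT z|disk_area. 4 * \<delta> powr p * (norm (u z) powr p + norm (v z) powr p)
      + 8 / (p * (p - 1)) * \<delta> powr (p - 2)
        * (norm (u z) powr p + norm (v z) powr p - 2 * norm (1 / 2 * (u z + v z)) powr p))"
  proof (rule integral_mono)
    show "integrable disk_area (\<lambda>z. norm (u z - v z) powr p)"
      by (rule Lp_disk_integrable[OF Lp_disk_diff[OF p0(2) u v]])
    fix z
    show "norm (u z - v z) powr p \<le> 4 * \<delta> powr p * (norm (u z) powr p + norm (v z) powr p)
      + 8 / (p * (p - 1)) * \<delta> powr (p - 2)
        * (norm (u z) powr p + norm (v z) powr p - 2 * norm (1 / 2 * (u z + v z)) powr p)"
      using norm_diff_powr_le[OF p \<delta>, of "u z" "v z"] by (simp add: norm_mult norm_divide)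
  qed (use int in \<open>intro Bochner_Integration.integrable_add Bochner_Integration.integrable_diff integrable_mult_right; simp\<close>)
  also have "\<dots> = 4 * \<delta> powr p * ((LINT z|disk_area. norm (u z) powr p) + (LINT z|disk_area. norm (v z) powr p))
    + 8 / (p * (p - 1)) * \<delta> powr (p - 2)
      * ((LINT z|disk_area. norm (u z) powr p) + (LINT z|disk_area. norm (v z) powr p)
         - 2 * (LINT z|disk_area. norm (1 / 2 * (u z + v z)) powr p))"
    using int by (simp del: norm_divide_numeral times_divide_eq_left)
  finally show ?thesis
    by (simp only: Lp_norm_powr[OF p0(1)])
qed

text \<open>Mean value theorem, with the derivative nondecreasing because p \<ge> 1. It turns an
  excess \<open>e\<close> of norms into an excess of their powers that is linear in
  \<open>e\<close>.\<close>

lemma powr_add_diff_le: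
  fixes d e p :: real
  assumes "1 \<le> p" "0 \<le> d" "0 \<le> e"
  shows "(d + e) powr p - d powr p \<le> p * (d + e) powr (p - 1) * e"
proof (cases "d = 0 \<or> e = 0")
  case True
  then show ?thesis
    using assms by (auto simp: powr_diff mult_right_mono[of 1 p "e powr p"] powr_gt_zero)
next
  case False
  with assms have "0 < d" "0 < e" by auto
  then have "\<exists>z>d. z < d + e \<and> (d + e) powr p - d powr p = (d + e - d) * (p * z powr (p - 1))"
    by (intro MVT2) (auto intro!: derivative_eq_intros)
  then obtain z where z: "d < z" "z < d + e" and eq: "(d + e) powr p - d powr p = e * (p * z powr (p - 1))"
    by auto
  have "z powr (p - 1) \<le> (d + e) powr (p - 1)"
    using z assms by (intro powr_mono2) auto
  then show ?thesis
    unfolding eq using assms by (simp add: mult_ac mult_left_mono)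
qed

section \<open>Second differences of the best approximant\<close>

theorem theorem4p2:
  fixes p q \<sigma> :: real and \<omega> fstar :: "complex \<Rightarrow> complex"
  assumes "1 < p" and "p \<le> 2"
    and "q = p / (p - 1)"
    and "\<sigma> > 0"
    and "\<omega> \<in> Lambda_class p \<sigma>"
    and "is_best_approximant p \<omega> fstar"
  shows "fstar \<in> Lambda_class p (\<sigma> / q)"
proof -
  define \<Delta> where "\<Delta> = (\<lambda>t u z. rotation (cis t) u z + rotation (cis (- t)) u z - 2 * u z)"
  have p: "1 < p" "p \<le> 2" "1 \<le> p" "0 < p"
    using assms by auto
  have f: "fstar \<in> bergman_space p" and fL: "fstar \<in> Lp_disk p"
    using assms by (auto simp: is_best_approximant_def bergman_space_def)
  have \<omega>: "\<omega> \<in> Lp_disk p"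
    using assms by (simp add: Lambda_class_def)
  obtain C0 where C0: "\<And>t. 0 \<le> t \<Longrightarrow> t \<le> pi \<Longrightarrow> Lp_norm p (\<Delta> t \<omega>) \<le> C0 * t powr \<sigma>"
    using assms by (auto simp: Lambda_class_def \<Delta>_def)
  define C where "C = \<bar>C0\<bar>"
  have C: "0 \<le> C" "Lp_norm p (\<Delta> t \<omega>) \<le> C * t powr \<sigma>" if "0 \<le> t" "t \<le> pi" for t
    using C0[OF that] mult_right_mono[OF abs_ge_self, of "t powr \<sigma>" C0] by (auto simp: C_def)
  define v where "v = (\<lambda>z. \<omega> z - fstar z)"
  define d where "d = Lp_norm p v"
  \<comment> \<open>Bounds \<open>d + e\<close> for all t \<le> \<pi>, which keeps the constant
    \<open>K\<close> independent of \<open>t\<close>.\<close>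
  define N where "N = d + C * pi powr \<sigma>"
  have d: "0 \<le> d" and v: "v \<in> Lp_disk p"
    unfolding d_def v_def using \<omega> fL p by (auto intro: Lp_norm_nonneg Lp_disk_diff)
  define K where "K = 4 * (2 * N powr p) + 8 / (p * (p - 1)) * (p * N powr (p - 1) * C)"
  have main: "Lp_norm p (\<Delta> t fstar) \<le> 2 * K powr (1 / p) * t powr (\<sigma> / 2)" if t: "0 < t" "t \<le> pi" for t
  proof -
    define e where "e = C * t powr \<sigma>"
    have e: "0 \<le> e" "d + e \<le> N" "Lp_norm p (\<Delta> t \<omega>) \<le> e"
      using C[of t] t assms by (auto simp: e_def N_def intro!: mult_left_mono powr_mono2)
    define ft where "ft = (\<lambda>z. 1 / 2 * (rotation (cis t) fstar z + rotation (cis (- t)) fstar z))"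
    have ft: "ft \<in> bergman_space p"
      unfolding ft_def using f p by (intro bergman_space_cmult bergman_space_add rotation_in_bergman_space) auto
    define u where "u = (\<lambda>z. \<omega> z - ft z)"
    have u: "u \<in> Lp_disk p"
      unfolding u_def using \<omega> ft p by (intro Lp_disk_diff) (auto simp: bergman_space_def)
    have R: "rotation (cis s) v \<in> Lp_disk p" "rotation (cis s) \<omega> \<in> Lp_disk p" "Lp_norm p (rotation (cis s) v) = d" for s
      unfolding d_def using v \<omega> by (auto intro: rotation_in_Lp_disk Lp_norm_rotation)
    \<comment> \<open>The error of \<open>ft\<close> is the mean of two rotations of
      \<open>v\<close>, each of norm \<open>d\<close>, minus half the second difference of
      \<omega>.\<close>
    have u_eq: "u = (\<lambda>z. 1 / 2 * ((rotation (cis t) v z + rotation (cis (- t)) v z) + (-1) * \<Delta> t \<omega> z))"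
      by (auto simp: fun_eq_iff u_def ft_def v_def \<Delta>_def rotation_def field_simps)
    have D: "\<Delta> t \<omega> \<in> Lp_disk p"
      unfolding \<Delta>_def using R \<omega> p by (intro Lp_disk_diff Lp_disk_add Lp_disk_cmult) auto
    have "Lp_norm p u \<le> 1 / 2 * ((d + d) + Lp_norm p (\<Delta> t \<omega>))"
    proof -
      have "Lp_norm p (\<lambda>z. (rotation (cis t) v z + rotation (cis (- t)) v z) + (-1) * \<Delta> t \<omega> z)
          \<le> Lp_norm p (\<lambda>z. rotation (cis t) v z + rotation (cis (- t)) v z) + Lp_norm p (\<lambda>z. (-1) * \<Delta> t \<omega> z)"
        using p R D by (intro Lp_norm_triangle Lp_disk_add Lp_disk_cmult) auto
      also have "Lp_norm p (\<lambda>z. rotation (cis t) v z + rotation (cis (- t)) v z) \<le> d + d"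
        using Lp_norm_triangle[OF p(3) R(1)[of t] R(1)[of "- t"]] by (simp add: R)
      also have "Lp_norm p (\<lambda>z. (-1) * \<Delta> t \<omega> z) = Lp_norm p (\<Delta> t \<omega>)"
        using p by (subst Lp_norm_cmult) auto
      finally show ?thesis
        unfolding u_eq using p by (subst Lp_norm_cmult) auto
    qed
    with e have u_le: "Lp_norm p u \<le> d + e"
      using Lp_norm_nonneg[of p "\<Delta> t \<omega>"] by simp
    \<comment> \<open>The mean of \<open>ft\<close> and \<open>fstar\<close> is itself a competitor,
      and its error is the midpoint of \<open>u\<close> and \<open>v\<close>.\<close>
    have "d \<le> Lp_norm p (\<lambda>z. \<omega> z - 1 / 2 * (ft z + fstar z))"
      unfolding d_def v_def using assms f ft p
      by (intro best_approximant_norm_le bergman_space_cmult bergman_space_add) auto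
    also have "(\<lambda>z. \<omega> z - 1 / 2 * (ft z + fstar z)) = (\<lambda>z. 1 / 2 * (u z + v z))"
      by (auto simp: fun_eq_iff u_def v_def field_simps)
    finally have mid: "d powr p \<le> Lp_norm p (\<lambda>z. 1 / 2 * (u z + v z)) powr p"
      using d p by (intro powr_mono2) auto
    have up: "Lp_norm p u powr p \<le> (d + e) powr p" "(d + e) powr p \<le> N powr p" "d powr p \<le> N powr p"
      using u_le e d p by (auto intro!: powr_mono2 Lp_norm_nonneg)
    \<comment> \<open>Since \<delta> squared is \<open>t powr \<sigma>\<close>, the two terms
      \<delta>^p and \<delta>^(p-2) e have the same order.\<close>
    define \<delta> where "\<delta> = t powr (\<sigma> / 2)"
    have \<delta>: "0 < \<delta>" using t by (simp add: \<delta>_def)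
    have e_eq: "\<delta> powr (p - 2) * e = C * \<delta> powr p"
      using t by (simp add: e_def \<delta>_def powr_powr field_simps flip: powr_add)
    \<comment> \<open>\<open>v\<close> contributes \<open>d powr p\<close> and the midpoint at least
      that much twice, leaving only the growth of the power from \<open>d\<close> to
      \<open>d + e\<close>.\<close>
    have deficit: "Lp_norm p u powr p + Lp_norm p v powr p - 2 * Lp_norm p (\<lambda>z. 1 / 2 * (u z + v z)) powr p
        \<le> p * N powr (p - 1) * e"
    proof -
      have "Lp_norm p u powr p + Lp_norm p v powr p - 2 * Lp_norm p (\<lambda>z. 1 / 2 * (u z + v z)) powr p
          \<le> (d + e) powr p - d powr p"
        using up mid by (simp add: d_def)
      also have "\<dots> \<le> p * (d + e) powr (p - 1) * e"
        using p d e by (intro powr_add_diff_le) auto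
      also have "\<dots> \<le> p * N powr (p - 1) * e"
        using p d e by (intro mult_left_mono mult_right_mono powr_mono2) auto
      finally show ?thesis .
    qed
    have "Lp_norm p (\<lambda>z. u z - v z) powr p \<le> 4 * \<delta> powr p * (Lp_norm p u powr p + Lp_norm p v powr p)
      + 8 / (p * (p - 1)) * \<delta> powr (p - 2)
        * (Lp_norm p u powr p + Lp_norm p v powr p - 2 * Lp_norm p (\<lambda>z. 1 / 2 * (u z + v z)) powr p)"
      by (rule Lp_norm_diff_powr_le[OF p(1,2) \<delta> u v])
    also have "\<dots> \<le> 4 * \<delta> powr p * (2 * N powr p) + 8 / (p * (p - 1)) * \<delta> powr (p - 2) * (p * N powr (p - 1) * e)"
      using up deficit p by (intro add_mono mult_left_mono) (auto simp: d_def)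
    also have "\<dots> = 4 * \<delta> powr p * (2 * N powr p) + 8 / (p * (p - 1)) * (p * N powr (p - 1)) * (\<delta> powr (p - 2) * e)"
      by simp
    also have "\<dots> = K * \<delta> powr p"
      unfolding e_eq K_def by (simp add: algebra_simps)
    finally have "(Lp_norm p (\<lambda>z. u z - v z) powr p) powr (1 / p) \<le> (K * \<delta> powr p) powr (1 / p)"
      using p by (intro powr_mono2) auto
    moreover have "0 \<le> K"
      using p C[of 0] by (simp add: K_def)
    ultimately have "Lp_norm p (\<lambda>z. u z - v z) \<le> K powr (1 / p) * \<delta>"
      using p \<delta> by (simp add: powr_powr powr_mult Lp_norm_nonneg)
    moreover have "\<Delta> t fstar = (\<lambda>z. (-2) * (u z - v z))"
      by (auto simp: fun_eq_iff u_def v_def ft_def \<Delta>_def field_simps)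
    then have "Lp_norm p (\<Delta> t fstar) = 2 * Lp_norm p (\<lambda>z. u z - v z)"
      using p Lp_norm_cmult[of p "-2" "\<lambda>z. u z - v z"] by simp
    ultimately show ?thesis
      by (simp add: \<delta>_def)
  qed
  \<comment> \<open>The hypothesis p \<le> 2 enters again: on the bounded range of \<open>t\<close>,
    the exponent \<sigma>/2 may be lowered to \<sigma>/q at the cost of a power of \<pi>.\<close>
  have "2 \<le> q"
    unfolding assms(3) using p by (simp add: le_divide_eq)
  then have exponent: "0 \<le> \<sigma> / 2 - \<sigma> / q"
    using frac_le[of \<sigma> \<sigma> 2 q] assms(4) by simp
  have "Lp_norm p (\<Delta> t fstar) \<le> 2 * K powr (1 / p) * pi powr (\<sigma> / 2 - \<sigma> / q) * t powr (\<sigma> / q)"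
    if t: "0 \<le> t" "t \<le> pi" for t
  proof (cases "t = 0")
    \<comment> \<open>At \<open>t = 0\<close> the right side is 0 because \<open>0 powr r\<close> is
      0; the second difference vanishes too.\<close>
    case True
    then show ?thesis
      by (simp add: \<Delta>_def rotation_def Lp_norm_def)
  next
    case False
    have "t powr (\<sigma> / 2) = t powr (\<sigma> / 2 - \<sigma> / q) * t powr (\<sigma> / q)"
      by (simp flip: powr_add)
    also have "\<dots> \<le> pi powr (\<sigma> / 2 - \<sigma> / q) * t powr (\<sigma> / q)"
      using t exponent by (intro mult_right_mono powr_mono2) auto
    finally have "2 * K powr (1 / p) * t powr (\<sigma> / 2)
        \<le> 2 * K powr (1 / p) * (pi powr (\<sigma> / 2 - \<sigma> / q) * t powr (\<sigma> / q))"
      by (intro mult_left_mono) auto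
    with main[of t] t False show ?thesis
      by (simp add: mult.assoc)
  qed
  then show ?thesis
    using fL unfolding Lambda_class_def \<Delta>_def by blast
qed

end
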